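(* Let $\epsilon=\epsilon_n>0$ satisfy $\epsilon^2\underline h\to\infty$ as $n\to\infty$, where $n$ ranges over powers of $2$. Define $$\mathcal R_\epsilon=\bigcup_{\mathbf a\in[\log_2 n]^d}\Big\{[2^{\mathbf a}\circ\mathbf t,\ 2^{\mathbf a}\circ(\mathbf t+\mathbf f)]:\ f_j\in[\lceil 8d/\epsilon^2\rceil],\ t_j\in[n/2^{a_j}],\ \forall j\in[d]\Big\}.$$ Then, for all $n$ large enough, $\mathcal R_\epsilon$ is an $\epsilon$-covering of $\mathcal R$ for the metric $\delta$; that is, for every $R\in\mathcal R$ there is $R'\in\mathcal R_\epsilon$ with $\delta(R,R')\le\epsilon$.
   Context: The dimension $d\ge1$ is fixed; $[k]=\{1,\dots,k\}$. Integers $1\le\underline h\le\overline h\le n/e$ (with $e=\exp(1)$) may depend on $n$ and satisfy $\underline h/\log n\to\infty$. $2^{\mathbf a}=(2^{a_1},\dots,2^{a_d})$ and $\circ$ is the componentwise product. $[\mathbf a,\mathbf b]=\times_{j=1}^d[a_j,b_j]$ denotes the discrete rectangle of integer points with these endpoints. For $\mathbf h\in[n]^d$, $\mathcal R(\mathbf h)=\{\times_{j=1}^d[v_j,v_j+h_j]:v_j\in[n-h_j]\ \forall j\in[d]\}$ and $\mathcal R=\bigcup_{\mathbf h\in[\underline h,\overline h]^d}\mathcal R(\mathbf h)$ (integer shapes). For discrete rectangles $R_0,R_1$, $\delta(R_0,R_1)\ge0$ is given by $\delta^2(R_0,R_1)=2\big(1-|R_0\cap R_1|/\sqrt{|R_0||R_1|}\big)$,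 with $|\cdot|$ the cardinality. *)

theory Defs
  imports "HOL-Analysis.Analysis"
begin

text \<open>
  The dimension \<open>d\<close> is \<open>CARD('d)\<close>, for a type \<open>'d\<close> of class \<open>finite\<close>. A discrete rectangle is
  an interval \<open>{a..b}\<close> of \<^typ>\<open>int ^ 'd\<close>: the order on vectors is componentwise, so this is the
  product of the integer intervals \<open>{a $ j..b $ j}\<close>. The product \<open>*\<close> of vectors is componentwise
  as well.
\<close>

definition rects_of_shape :: "nat \<Rightarrow> int ^ 'd \<Rightarrow> (int ^ 'd::finite) set set" where
  "rects_of_shape n h = {{v..v + h} | v. \<forall>j. v $ j \<in> {1..int n - h $ j}}"

definition rects :: "nat \<Rightarrow> nat \<Rightarrow> nat \<Rightarrow> (int ^ 'd::finite) set set" where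
  "rects n hlo hhi = (\<Union>h\<in>{h. \<forall>j. h $ j \<in> {int hlo..int hhi}}. rects_of_shape n h)"

text \<open>
  For finite nonempty \<open>R0\<close>, \<open>R1\<close> the radicand is nonnegative, because
  \<open>card (R0 \<inter> R1) \<le> sqrt (card R0 * card R1)\<close>.
\<close>

definition rect_dist :: "'a set \<Rightarrow> 'a set \<Rightarrow> real" where
  "rect_dist R0 R1 =
     sqrt (2 * (1 - real (card (R0 \<inter> R1)) / sqrt (real (card R0) * real (card R1))))"

definition pow2_vec :: "nat ^ 'd \<Rightarrow> int ^ 'd::finite" where
  "pow2_vec a = (\<chi> j. 2 ^ (a $ j))"

definition cover_rects :: "nat \<Rightarrow> real \<Rightarrow> (int ^ 'd::finite) set set" where
  "cover_rects n \<epsilon> =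
     (\<Union>a\<in>{a :: nat ^ 'd. \<forall>j. 1 \<le> a $ j \<and> real (a $ j) \<le> log 2 (real n)}.
        {{pow2_vec a * t..pow2_vec a * (t + f)} | t f.
           \<forall>j. f $ j \<in> {1..\<lceil>8 * real CARD('d) / \<epsilon>\<^sup>2\<rceil>} \<and>
               1 \<le> t $ j \<and> real_of_int (t $ j) \<le> real n / 2 ^ (a $ j)})"

definition is_covering :: "('b \<Rightarrow> 'b \<Rightarrow> real) \<Rightarrow> real \<Rightarrow> 'b set \<Rightarrow> 'b set \<Rightarrow> bool" where
  "is_covering \<delta> \<epsilon> C A \<longleftrightarrow> (\<forall>R\<in>A. \<exists>R'\<in>C. \<delta> R R' \<le> \<epsilon>)"

text \<open>The filter of \<open>n \<rightarrow> \<infinity>\<close> along powers of two.\<close>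

definition pow2_at_top :: "nat filter" where
  "pow2_at_top = inf at_top (principal (range (\<lambda>k. 2 ^ k)))"

lemma eventually_pow2_at_top:
  "eventually P pow2_at_top \<longleftrightarrow> (\<exists>N. \<forall>n\<ge>N. (\<exists>k. n = 2 ^ k) \<longrightarrow> P n)"
  by (auto simp: pow2_at_top_def eventually_inf_principal eventually_at_top_linorder)

end

theory Submission
  imports Defs
begin

text \<open>
  Write \<open>F = \<lceil>8d/\<epsilon>\<^sup>2\<rceil>\<close>. If \<open>\<epsilon>\<^sup>2 \<ge> 2\<close>, any two rectangles are \<open>\<epsilon>\<close>-close. Otherwise shrink
  each side of length \<open>h\<close> to the largest interval inside it with endpoints in \<open>s\<int>\<close>, where \<open>s\<close> is the
  least power of two with \<open>h \<le> sF\<close>. This loses less than \<open>2s < 4h/F \<le> \<epsilon>\<^sup>2h/(2d)\<close> per side, so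
  Bernoulli's inequality gives \<open>|R'| \<ge> (1 - \<epsilon>\<^sup>2/2)|R|\<close>. As \<open>R' \<subseteq> R\<close>,
  \<open>\<delta>\<^sup>2(R, R') = 2(1 - sqrt (|R'|/|R|)) \<le> 2(1 - |R'|/|R|) \<le> \<epsilon>\<^sup>2\<close>.
\<close>

text \<open>Reduces finiteness and cardinality of a box to those of a product of integer
  intervals.\<close>

lemma vec_atLeastAtMost_eq_image_PiE:
  fixes a b :: "int ^ 'd::finite"
  shows "{a..b} = vec_lambda ` (\<Pi>\<^sub>E j\<in>UNIV. {a $ j..b $ j})"
proof (intro equalityI subsetI)
  fix x assume "x \<in> {a..b}"
  then have "vec_nth x \<in> (\<Pi>\<^sub>E j\<in>UNIV. {a $ j..b $ j})"
    by (auto simp: less_eq_vec_def)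
  then show "x \<in> vec_lambda ` (\<Pi>\<^sub>E j\<in>UNIV. {a $ j..b $ j})"
    by (metis image_eqI vec_nth_inverse)
qed (auto simp: less_eq_vec_def PiE_iff)

lemma finite_vec_atLeastAtMost: "finite {a..b :: int ^ 'd::finite}"
  unfolding vec_atLeastAtMost_eq_image_PiE by (intro finite_imageI finite_PiE) auto

lemma card_vec_atLeastAtMost:
  fixes a b :: "int ^ 'd::finite"
  shows "card {a..b} = (\<Prod>j\<in>UNIV. nat (b $ j - a $ j + 1))"
proof -
  have "inj_on (vec_lambda :: ('d \<Rightarrow> int) \<Rightarrow> _) A" for A
    by (intro inj_onI) (metis vec_lambda_inverse UNIV_I)
  then show ?thesis
    unfolding vec_atLeastAtMost_eq_image_PiE by (simp add: card_image card_PiE algebra_simps)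
qed

text \<open>The last conclusion bounds the relative loss of length by 4/F, written without division.
  \<open>F < h\<close> forces a scale of at least 2, and \<open>4 \<le> F\<close> makes the scale so
  small against h that the rounded interval keeps positive length.\<close>

lemma dyadic_inner_interval:
  fixes v h F :: int
  assumes "1 \<le> v" "4 \<le> F" "F < h"
  obtains a :: nat and t f :: int where "1 \<le> a" "1 \<le> t" "1 \<le> f" "f \<le> F"
    "v \<le> 2 ^ a * t" "2 ^ a * (t + f) \<le> v + h" "F * (h - 2 ^ a * f) \<le> 4 * h"
proof -
  define a where "a = (LEAST a. h \<le> 2 ^ a * F)"
  define s :: int where "s = 2 ^ a"
  \<comment> \<open>t is the ceiling of v/s, as \<open>div\<close> rounds down, and t + f is the
    floor of (v + h)/s: both endpoints move inward to multiples of s.\<close>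
  define t where "t = - ((- v) div s)"
  define f where "f = (v + h) div s - t"
  \<comment> \<open>The exponent \<open>nat h\<close> shows that some power of two qualifies, so
    \<open>LeastI\<close> applies to \<open>a\<close>.\<close>
  have "h < 2 ^ nat h"
    using of_nat_less_two_power[of "nat h", where 'a=int] assms by simp
  also have "\<dots> \<le> 2 ^ nat h * F"
    using assms by simp
  finally have "h \<le> 2 ^ nat h * F" by simp
  then have le: "h \<le> s * F"
    unfolding s_def a_def by (rule LeastI)
  have "a \<noteq> 0"
  proof
    assume "a = 0"
    then show False using le assms(3) by (simp add: s_def)
  qed
  then obtain b where b: "a = Suc b"
    using not0_implies_Suc by blast
  \<comment> \<open>By minimality s/2 is too small a scale, hence sF < 2h.\<close>
  have "\<not> h \<le> 2 ^ b * F"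
    using b not_less_Least[of b "\<lambda>a. h \<le> 2 ^ a * F"] by (simp add: a_def)
  then have sF: "s * F < 2 * h"
    by (simp add: s_def b)
  have s: "s > 0" by (simp add: s_def)
  have "s * 4 \<le> s * F"
    using s assms by simp
  with sF have s2: "2 * s < h" by linarith
  have "s * t = - (s * ((- v) div s))" "s * (t + f) = s * ((v + h) div s)"
    by (simp_all add: t_def f_def)
  then have t1: "v \<le> s * t" "s * t < v + s" and f1: "s * (t + f) \<le> v + h" "v + h < s * (t + f) + s"
    using mult_div_mod_eq[of s "- v"] pos_mod_bound[OF s, of "- v"] pos_mod_sign[OF s, of "- v"]
      mult_div_mod_eq[of s "v + h"] pos_mod_bound[OF s, of "v + h"] pos_mod_sign[OF s, of "v + h"]
    by linarith+
  \<comment> \<open>Each endpoint moves by less than s. Since 2s < h, a positive length s * f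
    remains.\<close>
  have loss: "h - s * f \<le> 2 * s" and gain: "s * f \<le> h"
    using t1 f1 by (auto simp: algebra_simps)
  show thesis
  proof (rule that[of a t f], unfold s_def[symmetric])
    show "1 \<le> a" using b by simp
    have "0 < s * t" using t1 assms by linarith
    then show "1 \<le> t" using s by (simp add: zero_less_mult_iff)
    have "0 < s * f" using loss s2 by linarith
    then show "1 \<le> f" using s by (simp add: zero_less_mult_iff)
    have "s * f \<le> s * F" using gain le by linarith
    then show "f \<le> F" using s by simp
    have "F * (h - s * f) \<le> F * (2 * s)"
      using loss assms by (intro mult_left_mono) auto
    then show "F * (h - s * f) \<le> 4 * h"
      using sF by (simp add: algebra_simps)
  qed (use t1 f1 in auto)
qed

lemma rect_dist_le_sqrt2: "rect_dist R R' \<le> sqrt 2"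
  by (simp add: rect_dist_def)

lemma rect_dist_subset_le:
  assumes "finite R" "R' \<subseteq> R" "0 \<le> \<epsilon>"
    and card: "(1 - \<epsilon>\<^sup>2 / 2) * real (card R) \<le> real (card R')" and "R \<noteq> {}"
  shows "rect_dist R R' \<le> \<epsilon>"
proof -
  define x y where "x = real (card R)" and "y = real (card R')"
  have x: "x > 0" and y: "0 \<le> y" "y \<le> x"
    using assms by (auto simp: x_def y_def card_gt_0_iff card_mono)
  have "sqrt (x * y) \<le> sqrt (x * x)"
    using x y by (intro real_sqrt_le_mono mult_left_mono) auto
  then have "sqrt (x * y) \<le> x" using x by simp
  have "1 - \<epsilon>\<^sup>2 / 2 \<le> y / x"
    using card x by (simp add: x_def y_def field_simps)
  \<comment> \<open>For y = 0 both sides vanish, the right one by the convention 0 / 0 = 0.\<close>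
  also have "y / x \<le> y / sqrt (x * y)"
  proof (cases "y = 0")
    case False
    then show ?thesis
      using x y \<open>sqrt (x * y) \<le> x\<close> by (intro divide_left_mono) auto
  qed simp
  finally have "2 * (1 - y / sqrt (x * y)) \<le> \<epsilon>\<^sup>2" by simp
  moreover have "R \<inter> R' = R'" using assms by auto
  ultimately show ?thesis
    using assms(3) unfolding rect_dist_def by (intro real_le_lsqrt) (simp_all add: x_def y_def)
qed

text \<open>The covering at a single n: divergence of \<open>\<epsilon>\<^sup>2 * hlo\<close> enters
  only through the threshold 8d + 2.\<close>

lemma is_covering_cover_rects:
  fixes \<epsilon> :: real
  assumes "1 \<le> hlo" "\<epsilon> > 0" and large: "8 * real CARD('d::finite) + 2 \<le> \<epsilon>\<^sup>2 * real hlo"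
  shows "is_covering rect_dist \<epsilon> (cover_rects n \<epsilon> :: (int ^ 'd) set set) (rects n hlo hhi)"
  unfolding is_covering_def
proof
  let ?d = "real CARD('d)"
  define F where "F = \<lceil>8 * ?d / \<epsilon>\<^sup>2\<rceil>"
  fix R :: "(int ^ 'd) set"
  assume "R \<in> rects n hlo hhi"
  then obtain h v where R: "R = {v..v + h}" and h': "\<forall>j. h $ j \<in> {int hlo..int hhi}"
    and v': "\<forall>j. v $ j \<in> {1..int n - h $ j}"
    unfolding rects_def rects_of_shape_def by blast
  have h: "int hlo \<le> h $ j" for j
    using h' by simp
  have v: "1 \<le> v $ j" "v $ j + h $ j \<le> int n" for j
    using v'[rule_format, of j] by auto
  have h1: "1 \<le> h $ j" for j
    using h[of j] assms(1) by linarith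
  then have h0: "0 \<le> h $ j" for j
    by (rule order_trans[OF zero_le_one])
  have d: "?d \<ge> 1"
    using zero_less_card_finite[where 'a='d] by linarith
  have pos: "8 * ?d / \<epsilon>\<^sup>2 > 0" using d assms(2) by simp
  have cover_rectsI: "{pow2_vec a * t..pow2_vec a * (t + f)} \<in> cover_rects n \<epsilon>"
    if "\<And>j. 1 \<le> a $ j" "\<And>j. 2 ^ (a $ j) * t $ j \<le> int n" "\<And>j. 1 \<le> t $ j"
      "\<And>j. 1 \<le> f $ j" "\<And>j. f $ j \<le> F" for a :: "nat ^ 'd" and t f
  proof -
    have "real (a $ j) \<le> log 2 (real n)" "real_of_int (t $ j) \<le> real n / 2 ^ (a $ j)" for j
    proof -
      have "real_of_int (2 ^ (a $ j) * t $ j) \<le> real_of_int (int n)"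
        using that(2)[of j] by (rule of_int_le_iff[THEN iffD2])
      then have le: "2 ^ (a $ j) * real_of_int (t $ j) \<le> real n" by simp
      then show "real_of_int (t $ j) \<le> real n / 2 ^ (a $ j)"
        by (simp add: field_simps)
      \<comment> \<open>The bound on the exponent comes for free: \<open>1 \<le> t $ j\<close> gives
        2^a <= 2^a t <= n.\<close>
      have "2 ^ (a $ j) * 1 \<le> 2 ^ (a $ j) * t $ j"
        using that(3)[of j] by (intro mult_left_mono) auto
      also note that(2)[of j]
      finally have "int (2 ^ (a $ j)) \<le> int n" by simp
      then have "2 ^ (a $ j) \<le> n"
        by (rule of_nat_le_iff[THEN iffD1])
      then show "real (a $ j) \<le> log 2 (real n)"
        by (rule le_log2_of_power)
    qed
    then show ?thesis
      using that(1,3-5) unfolding cover_rects_def F_def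
      by (intro UN_I[of a] CollectI exI[of _ t] exI[of _ f] conjI allI) auto
  qed
  show "\<exists>R'\<in>cover_rects n \<epsilon>. rect_dist R R' \<le> \<epsilon>"
  proof (cases "\<epsilon>\<^sup>2 \<ge> 2")
    case True
    \<comment> \<open>It suffices that the cover is nonempty; the box with all sides [2, 4] is a
      member, since n is at least v + h, hence at least 2.\<close>
    have "1 \<le> F" using pos by (simp add: F_def)
    moreover have "2 \<le> int n"
      using v[of undefined] h1[of undefined] by linarith
    ultimately have "{pow2_vec 1 * 1..pow2_vec 1 * (1 + 1 :: int ^ 'd)} \<in> cover_rects n \<epsilon>"
      by (intro cover_rectsI) auto
    moreover have "sqrt 2 \<le> \<epsilon>"
      using True assms(2) by (simp add: real_le_lsqrt)
    ultimately show ?thesis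
      using rect_dist_le_sqrt2 order_trans by blast
  next
    case False
    have F_ge: "8 * ?d / \<epsilon>\<^sup>2 \<le> F" by (simp add: F_def)
    have e2: "\<epsilon>\<^sup>2 > 0" "\<epsilon>\<^sup>2 < 2" using False assms(2) by auto
    have "4 * \<epsilon>\<^sup>2 < 8 * ?d" using e2 d by linarith
    then have "4 < 8 * ?d / \<epsilon>\<^sup>2"
      using e2 by (simp only: pos_less_divide_eq)
    then have F4: "4 \<le> F" using F_ge by linarith
    \<comment> \<open>Rounding up to F costs less than 1, which is below
      \<open>2 / \<epsilon>\<^sup>2\<close>; this is what the summand 2 in \<open>large\<close> pays
      for.\<close>
    have "8 * ?d / \<epsilon>\<^sup>2 + 1 < (8 * ?d + 2) / \<epsilon>\<^sup>2"
      using e2 by (simp add: add_divide_distrib)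
    also have "\<dots> \<le> real hlo"
      using large e2 by (simp add: pos_divide_le_eq mult.commute)
    finally have "F < int hlo"
      unfolding F_def by linarith
    then have Fh: "F < h $ j" for j
      using h[of j] by linarith
    have "\<forall>j. \<exists>a t f. 1 \<le> a \<and> 1 \<le> t \<and> 1 \<le> f \<and> f \<le> F \<and> v $ j \<le> 2 ^ a * t \<and>
        2 ^ a * (t + f) \<le> v $ j + h $ j \<and> F * (h $ j - 2 ^ a * f) \<le> 4 * h $ j"
      using dyadic_inner_interval[OF v(1) F4 Fh] by metis
    then obtain a :: "'d \<Rightarrow> nat" and t f :: "'d \<Rightarrow> int" where atf: "\<And>j. 1 \<le> a j"
      "\<And>j. 1 \<le> t j" "\<And>j. 1 \<le> f j" "\<And>j. f j \<le> F" "\<And>j. v $ j \<le> 2 ^ a j * t j"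
      "\<And>j. 2 ^ a j * (t j + f j) \<le> v $ j + h $ j"
      "\<And>j. F * (h $ j - 2 ^ a j * f j) \<le> 4 * h $ j"
      by metis
    define p where "p = pow2_vec (vec_lambda a)"
    define R' where "R' = {p * vec_lambda t..p * (vec_lambda t + vec_lambda f)}"
    have "2 ^ a j * t j \<le> int n" for j
    proof -
      have "2 ^ a j * t j \<le> 2 ^ a j * (t j + f j)"
        using atf(3)[of j] by simp
      then show ?thesis using atf(6)[of j] v(2)[of j] by linarith
    qed
    then have "R' \<in> cover_rects n \<epsilon>"
      unfolding R'_def p_def by (intro cover_rectsI) (use atf in auto)
    moreover have "rect_dist R R' \<le> \<epsilon>"
    proof (rule rect_dist_subset_le)
      show "finite R" by (simp add: R finite_vec_atLeastAtMost)
      show "R' \<subseteq> R"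
        unfolding R R'_def p_def pow2_vec_def
        by (rule atLeastatMost_subset_iff[THEN iffD2]) (use atf in \<open>simp add: less_eq_vec_def\<close>)
      show "R \<noteq> {}"
        using h0 by (simp add: R less_eq_vec_def)
      \<comment> \<open>The relative loss allowed per side: d such losses add up to
        \<open>\<epsilon>\<^sup>2 / 2\<close>.\<close>
      define y where "y = \<epsilon>\<^sup>2 / (2 * ?d)"
      have "\<epsilon>\<^sup>2 \<le> 2 * ?d" using e2 d by linarith
      then have y: "0 \<le> y" "y \<le> 1"
        by (auto simp: y_def)
      \<comment> \<open>A side of length h has h + 1 points. The extra point does no harm, because 1
        - y <= 1.\<close>
      have side: "(1 - y) * real_of_int (h $ j + 1) \<le> real_of_int (2 ^ a j * f j + 1)" for j
      proof -
        have "real_of_int (F * (h $ j - 2 ^ a j * f j)) \<le> real_of_int (4 * h $ j)"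
          using atf(7)[of j] by (rule of_int_le_iff[THEN iffD2])
        then have "real_of_int (h $ j - 2 ^ a j * f j) \<le> 4 / real_of_int F * real_of_int (h $ j)"
          using F4 by (simp add: field_simps)
        \<comment> \<open>Here the constant 8d is used: 4/F <= y says exactly that
          \<open>F \<ge> 8 * d / \<epsilon>\<^sup>2\<close>.\<close>
        also have "4 / real_of_int F \<le> y"
        proof -
          have "8 * ?d \<le> F * \<epsilon>\<^sup>2"
            using F_ge e2 by (simp add: pos_divide_le_eq)
          then show ?thesis
            using F4 by (simp add: y_def divide_simps mult.commute)
        qed
        then have "4 / real_of_int F * real_of_int (h $ j) \<le> y * real_of_int (h $ j)"
          using h1[of j] by (intro mult_right_mono) auto
        finally show ?thesis using y by (simp add: algebra_simps)
      qed
      have "1 - \<epsilon>\<^sup>2 / 2 = 1 + ?d * (- y)"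
        using d by (simp add: y_def)
      also have "\<dots> \<le> (1 - y) ^ CARD('d)"
        using Bernoulli_inequality[of "- y" "CARD('d)"] y by simp
      finally have "(1 - \<epsilon>\<^sup>2 / 2) * real (card R) \<le> (1 - y) ^ CARD('d) * real (card R)"
        by (rule mult_right_mono) simp
      also have "\<dots> = (\<Prod>j\<in>UNIV. (1 - y) * real_of_int (h $ j + 1))"
      proof -
        have "real (nat (h $ j + 1)) = real_of_int (h $ j + 1)" for j
          using h1[of j] by simp
        then show ?thesis
          by (simp add: R card_vec_atLeastAtMost prod.distrib)
      qed
      \<comment> \<open>Sidewise bounds multiply because y <= 1 keeps the smaller factors
        nonnegative.\<close>
      also have "\<dots> \<le> (\<Prod>j\<in>UNIV. real_of_int (2 ^ a j * f j + 1))"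
      proof (intro prod_mono conjI)
        show "0 \<le> (1 - y) * real_of_int (h $ j + 1)" for j
          using y h1[of j] by (intro mult_nonneg_nonneg) auto
      qed (rule side)
      also have "\<dots> = real (card R')"
      proof -
        have "real (nat (2 ^ a j * f j + 1)) = real_of_int (2 ^ a j * f j + 1)" for j
          using atf(3)[of j] by simp
        then show ?thesis
          by (simp add: R'_def p_def pow2_vec_def card_vec_atLeastAtMost algebra_simps)
      qed
      finally show "(1 - \<epsilon>\<^sup>2 / 2) * real (card R) \<le> real (card R')" .
    qed (use assms(2) in simp)
    ultimately show ?thesis by blast
  qed
qed

theorem proposition8:
  fixes hlo hhi :: "nat \<Rightarrow> nat" and \<epsilon> :: "nat \<Rightarrow> real"
  assumes "\<forall>\<^sub>F n in pow2_at_top.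
      1 \<le> hlo n \<and> hlo n \<le> hhi n \<and> real (hhi n) \<le> real n / exp 1"
    and "filterlim (\<lambda>n. real (hlo n) / ln (real n)) at_top pow2_at_top"
    and "\<And>n. \<epsilon> n > 0"
    and "filterlim (\<lambda>n. (\<epsilon> n)\<^sup>2 * real (hlo n)) at_top pow2_at_top"
  shows "\<forall>\<^sub>F n in pow2_at_top.
      is_covering rect_dist (\<epsilon> n)
        (cover_rects n (\<epsilon> n) :: (int ^ 'd::finite) set set)
        (rects n (hlo n) (hhi n))"
proof -
  have "\<forall>\<^sub>F n in pow2_at_top. 8 * real CARD('d) + 2 \<le> (\<epsilon> n)\<^sup>2 * real (hlo n)"
    using assms(4) by (simp add: filterlim_at_top)
  with assms(1) show ?thesis
    by eventually_elim (use assms(3) in \<open>auto intro: is_covering_cover_rects\<close>)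
qed

end
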